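(* Let $C_0,C_1,C_2,C_3>0$ with $C_3<\min\{C_0,C_1+C_2\}$, let $\beta\in[0,1]$, and let $\xi\in[0,1]$ satisfy $1-\frac{C_2}{C_3}<\xi<\frac{C_1}{C_3}$ and $\xi>\beta$. Consider the Poincaré map $$Fv=\min\{C_1,\max\{A_1,\,C_3-\tfrac{1-\xi}{\xi}v\}\},\qquad A_1=\max\{C_3-(1-\xi)C_0,\;C_3-C_2,\;\beta C_3\}.$$ Then $F$ has one periodical point of period 1, $v^*=\xi C_3$. When $\xi<\frac12$, it has two periodical points of period 2, $$v^-=\max\{A_1,\,C_3-\tfrac{1-\xi}{\xi}C_1\}<v^*\quad\text{and}\quad v^+=\min\{C_1,\,C_3-\tfrac{1-\xi}{\xi}A_1\}>v^*.$$ When $\xi=\frac12$, it has an infinite number of periodical points of period 2 between (inclusively) $v^-=\max\{A_1,C_3-C_1\}$ and $v^+=\min\{C_1,C_3-A_1\}$. The map has no other periodical points (in particular, for $\xi>\frac12$ its only periodical point is $v^*$).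
   Context: The setting is a diverge-merge (DM) traffic network: upstream link 0, two parallel intermediate links 1 and 2, and downstream link 3. $C_a>0$ is the capacity of link $a$; $\beta$ is the merging ratio of link 1; $\xi$ is the constant proportion of vehicles choosing link 1. The variable $v\in[0,C_1]$ is the out-flux of link 1, and $F$ maps $[0,C_1]$ to itself. A point $v$ is a periodical point of period $n$ of $F$ if $F^nv=v$ and $F^kv\ne v$ for $1\le k<n$. *)

theory Defs
  imports Complex_Main
begin

text \<open>Points \<open>v\<close> of the domain \<open>D\<close> with least period \<open>n\<close>.  The clause \<open>1 \<le> n\<close> is needed because
  \<open>f ^^ 0\<close> is the identity, so every point would otherwise have period 0.\<close>

definition periodical_points :: "'a set \<Rightarrow> ('a \<Rightarrow> 'a) \<Rightarrow> nat \<Rightarrow> 'a set" where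
  "periodical_points D f n =
     {v \<in> D. 1 \<le> n \<and> (f ^^ n) v = v \<and> (\<forall>k. 1 \<le> k \<and> k < n \<longrightarrow> (f ^^ k) v \<noteq> v)}"

definition dm_A1 :: "real \<Rightarrow> real \<Rightarrow> real \<Rightarrow> real \<Rightarrow> real \<Rightarrow> real" where
  "dm_A1 C0 C2 C3 \<beta> \<xi> = Max {C3 - (1 - \<xi>) * C0, C3 - C2, \<beta> * C3}"

text \<open>The formula below makes sense on all reals; the domain of the Poincare map is \<open>{0..C1}\<close>, which
  it maps to itself (see \<open>poincare_map_self\<close>).\<close>

definition poincare_map ::
  "real \<Rightarrow> real \<Rightarrow> real \<Rightarrow> real \<Rightarrow> real \<Rightarrow> real \<Rightarrow> real \<Rightarrow> real" where
  "poincare_map C0 C1 C2 C3 \<beta> \<xi> v =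
     min C1 (max (dm_A1 C0 C2 C3 \<beta> \<xi>) (C3 - (1 - \<xi>) / \<xi> * v))"

lemma poincare_map_self:
  assumes "0 \<le> C1" "0 \<le> C3" "0 \<le> \<beta>"
  shows "poincare_map C0 C1 C2 C3 \<beta> \<xi> ` {0..C1} \<subseteq> {0..C1}"
proof -
  have "0 \<le> \<beta> * C3" using assms by simp
  then have "0 \<le> dm_A1 C0 C2 C3 \<beta> \<xi>" by (auto simp: dm_A1_def)
  then show ?thesis using assms by (auto simp: poincare_map_def)
qed

end

theory Submission
  imports Defs
begin

text \<open>Since \<open>C3 = \<xi> C3 + (1 - \<xi>) C3\<close>, the Poincare map is the reflection with factor
  \<open>r = (1 - \<xi>) / \<xi>\<close> about \<open>c = \<xi> C3\<close>, clamped to an interval \<open>{A..C}\<close> around \<open>c\<close>. It is antitone, so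
  its square is monotone, and a monotone map of a linear order has no periodic points but fixed
  points; hence all periods are 1 or 2. A point of period 2 cannot exist for \<open>r < 1\<close> (the map
  contracts towards \<open>c\<close>), forms with its image an unclamped reflected pair for \<open>r = 1\<close>, and has a
  clamped orbit, hence one through \<open>A\<close> or \<open>C\<close>, for \<open>r > 1\<close>.\<close>

section \<open>Periodic points of monotone and antitone maps\<close>

lemma mono_funpow_fixpoint:
  fixes g :: "'a::linorder \<Rightarrow> 'a"
  assumes "mono g" and "(g ^^ n) v = v" and "0 < n"
  shows "g v = v"
proof -
  obtain m where n: "n = Suc m"
    using \<open>0 < n\<close> gr0_implies_Suc by blast
  \<comment> \<open>Either way the whole orbit of \<open>v\<close> is monotone, so
    \<open>g v\<close> is squeezed between \<open>v\<close> and its return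
    \<open>(g ^^ n) v = v\<close>.\<close>
  consider "v \<le> g v" | "g v \<le> v"
    using linear by blast
  then show ?thesis
  proof cases
    case 1
    then have "(g ^^ k) v \<le> (g ^^ Suc k) v" for k
      using funpow_mono[OF \<open>mono g\<close> 1, of k] by (simp add: funpow_swap1)
    then have "mono (\<lambda>k. (g ^^ k) v)"
      by (simp only: mono_iff_le_Suc) blast
    then have "(g ^^ Suc 0) v \<le> (g ^^ n) v"
      unfolding n by (rule monoD) simp
    then show ?thesis
      using 1 assms(2) by simp
  next
    case 2
    then have "(g ^^ Suc k) v \<le> (g ^^ k) v" for k
      using funpow_mono[OF \<open>mono g\<close> 2, of k] by (simp add: funpow_swap1)
    then have "antimono (\<lambda>k. (g ^^ k) v)"
      by (simp only: antimono_iff_le_Suc) blast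
    then have "(g ^^ n) v \<le> (g ^^ Suc 0) v"
      unfolding n by (rule antimonoD) simp
    then show ?thesis
      using 2 assms(2) by simp
  qed
qed

lemma periodical_points_1: "periodical_points D f 1 = {v \<in> D. f v = v}"
  by (auto simp: periodical_points_def)

lemma periodical_points_2: "periodical_points D f 2 = {v \<in> D. f (f v) = v \<and> f v \<noteq> v}"
proof -
  have "(\<forall>k::nat. 1 \<le> k \<and> k < 2 \<longrightarrow> (f ^^ k) v \<noteq> v) \<longleftrightarrow> f v \<noteq> v" for v
  proof -
    have "1 \<le> k \<and> k < 2 \<longleftrightarrow> k = 1" for k :: nat
      by linarith
    then show ?thesis
      by simp
  qed
  then show ?thesis
    by (simp add: periodical_points_def numeral_2_eq_2)
qed

text \<open>A point that returns after \<open>n\<close> steps of \<open>f\<close> also returns after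
  \<open>n\<close> steps of the monotone \<open>f ^^ 2\<close>, so it is fixed by
  \<open>f ^^ 2\<close>; as 2 < \<open>n\<close>, its least period is not \<open>n\<close>.\<close>

lemma antimono_periodical_points_empty:
  fixes f :: "'a::linorder \<Rightarrow> 'a"
  assumes "antimono f" and "3 \<le> n"
  shows "periodical_points D f n = {}"
proof -
  have "f (f v) = v" if "(f ^^ n) v = v" for v
  proof -
    have "mono (f ^^ 2)"
      using \<open>antimono f\<close> by (auto simp: monotone_def numeral_2_eq_2)
    moreover have "((f ^^ 2) ^^ n) v = v"
    proof -
      have "((f ^^ 2) ^^ n) v = (f ^^ (n + n)) v"
        by (simp only: funpow_mult mult_2)
      also have "\<dots> = v"
        using that by (simp add: funpow_add)
      finally show ?thesis .
    qed
    ultimately have "(f ^^ 2) v = v"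
      using \<open>3 \<le> n\<close> by (intro mono_funpow_fixpoint) auto
    then show ?thesis
      by (simp add: numeral_2_eq_2)
  qed
  moreover have "(f ^^ 2) v \<noteq> v" if "v \<in> periodical_points D f n" for v
    using that \<open>3 \<le> n\<close> by (simp add: periodical_points_def)
  ultimately show ?thesis
    by (force simp: periodical_points_def numeral_2_eq_2)
qed

section \<open>Fixed points of a clamped reflection and of its square\<close>

locale clamped_reflection =
  fixes A C c r :: real
  assumes A_le: "A \<le> c" and c_le: "c \<le> C" and r_nonneg: "0 \<le> r"
begin

definition F :: "real \<Rightarrow> real" where
  "F v = min C (max A (c - r * (v - c)))"

lemma F_in: "F v \<in> {A..C}"
  using A_le c_le by (auto simp: F_def)

lemma antimono_F: "antimono F"
proof (rule antimonoI)
  fix x y :: real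
  assume "x \<le> y"
  then have "r * (x - c) \<le> r * (y - c)"
    using r_nonneg by (simp add: mult_left_mono)
  then show "F y \<le> F x"
    by (auto simp: F_def)
qed

lemma F_center: "F c = c"
  using A_le c_le by (auto simp: F_def)

lemma F_fixpoint_iff: "F v = v \<longleftrightarrow> v = c"
proof
  assume v: "F v = v"
  then show "v = c"
    \<comment> \<open>Antitonicity and \<open>F c = c\<close> put \<open>v\<close> and
      \<open>F v\<close> on opposite sides of \<open>c\<close>.\<close>
    using antimonoD[OF antimono_F, of v c] antimonoD[OF antimono_F, of c v] F_center
    by linarith
qed (simp add: F_center)

text \<open>Clamping to an interval that contains \<open>c\<close> never moves a point away from
  \<open>c\<close>.\<close>

lemma F_dist: "\<bar>F v - c\<bar> \<le> r * \<bar>v - c\<bar>"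
proof -
  have "\<bar>F v - c\<bar> \<le> \<bar>r * (v - c)\<bar>"
    using A_le c_le unfolding F_def by linarith
  then show ?thesis
    using r_nonneg by (simp add: abs_mult)
qed

lemma F_F_eq_contracting:
  assumes "r < 1" and "F (F v) = v"
  shows "v = c"
proof -
  \<comment> \<open>Of \<open>v\<close> and \<open>F v\<close>, which \<open>F\<close> exchanges,
    one is not brought nearer to \<open>c\<close>; this is applied to that one.\<close>
  have "F w = w" if "\<bar>w - c\<bar> \<le> \<bar>F w - c\<bar>" for w
  proof -
    have "\<bar>w - c\<bar> \<le> r * \<bar>w - c\<bar>"
      using that F_dist[of w] by linarith
    then have "w = c"
      using \<open>r < 1\<close> by (simp add: mult_le_cancel_right1)
    then show ?thesis
      by (simp add: F_center)
  qed
  then show ?thesis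
    using \<open>F (F v) = v\<close> F_fixpoint_iff by (metis linear)
qed

text \<open>The interval is the intersection of \<open>{A..C}\<close> with its mirror image about
  \<open>c\<close>: there no clamp acts, and every second iterate lands there.\<close>

lemma F_F_eq_isometric:
  assumes "r = 1"
  shows "F (F v) = v \<longleftrightarrow> v \<in> {max A (2 * c - C)..min C (2 * c - A)}"
proof
  assume v: "F (F v) = v"
  have F_alt: "F u = min C (max A (2 * c - u))" for u
    unfolding F_def unfolding \<open>r = 1\<close> by simp
  have "F w \<in> {2 * c - C..2 * c - A}" if "w \<in> {A..C}" for w
    using that A_le c_le by (auto simp: F_alt)
  from this[OF F_in[of v]] show "v \<in> {max A (2 * c - C)..min C (2 * c - A)}"
    using F_in[of "F v"] unfolding v by simp
next
  assume v: "v \<in> {max A (2 * c - C)..min C (2 * c - A)}"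
  then have "F v = 2 * c - v"
    unfolding F_def unfolding \<open>r = 1\<close> by simp
  then show "F (F v) = v"
    using v unfolding F_def unfolding \<open>r = 1\<close> by simp
qed

text \<open>Either \<open>A\<close> is sent to \<open>C\<close>, or \<open>F A\<close> stays below
  the clamp. In that case the way back, stretched by \<open>r \<ge> 1\<close>, reaches
  \<open>A\<close> or beyond and is clamped there, and from the farther point \<open>C\<close>
  likewise. The argument for \<open>C\<close> is symmetric.\<close>

lemma F_expanding_endpoints:
  assumes "1 \<le> r"
  shows "F (F C) = F A" and "F (F A) = F C"
proof -
  have 1: "r * (c - A) \<le> r * (r * (c - A))" "c - A \<le> r * (c - A)"
    and 2: "r * (C - c) \<le> r * (r * (C - c))" "C - c \<le> r * (C - c)"
    using A_le c_le assms by (simp_all add: mult_left_mono mult_right_mono[of 1 r, simplified])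
  show "F (F A) = F C"
  proof (cases "c + r * (c - A) \<le> C")
    case True
    then have "F A = c + r * (c - A)"
      using A_le c_le 1 by (simp add: F_def algebra_simps)
    then have "F (F A) = A"
      using 1 A_le c_le by (simp add: F_def)
    moreover have "r * (c - A) \<le> C - c"
      using True by simp
    then have "F C = A"
      using 1 2 A_le c_le by (simp add: F_def)
    ultimately show ?thesis
      by simp
  next
    case False
    then have "F A = C"
      using A_le c_le by (simp add: F_def algebra_simps)
    then show ?thesis
      by simp
  qed
  show "F (F C) = F A"
  proof (cases "A \<le> c - r * (C - c)")
    case True
    then have "F C = c - r * (C - c)"
      using A_le c_le 2 by (simp add: F_def)
    then have "F (F C) = C"
      using 1 2 A_le c_le by (simp add: F_def)
    moreover have "F A = C"
      using True 1 2 A_le c_le by (simp add: F_def algebra_simps)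
    ultimately show ?thesis
      by simp
  next
    case False
    then have "F C = A"
      using A_le c_le by (simp add: F_def)
    then show ?thesis
      by simp
  qed
qed

lemma F_F_eq_expanding:
  assumes "1 < r"
  shows "F (F v) = v \<longleftrightarrow> v \<in> {c, F A, F C}"
proof
  assume v: "F (F v) = v"
  have clamped: "w = A \<or> w = C \<or> w = c - r * (u - c)" if "w = F u" for u w
    using that by (auto simp: F_def min_def max_def)
  \<comment> \<open>Both \<open>v\<close> and \<open>F v\<close> are values of \<open>F\<close>, so
    each is an end of the interval or an unclamped reflection. If neither is clamped, two steps
    multiply \<open>v - c\<close> by \<open>r * r > 1\<close>, which forces
    \<open>v = c\<close>.\<close>
  consider "v \<in> {A, C}" | "F v \<in> {A, C}"
    | "v = c - r * (F v - c)" "F v = c - r * (v - c)"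
    using clamped[of v "F v"] clamped[of "F v" v] v by auto
  then show "v \<in> {c, F A, F C}"
  proof cases
    case 1
    then show ?thesis
      using v F_expanding_endpoints \<open>1 < r\<close> by auto
  next
    case 2
    then show ?thesis
      using v by auto
  next
    case 3
    then have "(r * r - 1) * (v - c) = 0"
      by algebra
    moreover have "1 < r * r"
      using \<open>1 < r\<close> by (simp add: less_1_mult)
    ultimately show ?thesis
      by simp
  qed
next
  assume "v \<in> {c, F A, F C}"
  then show "F (F v) = v"
    using F_expanding_endpoints \<open>1 < r\<close> F_center by auto
qed

lemma F_C_less:
  assumes "0 < r" and "A < c" and "c < C"
  shows "F C < c"
proof -
  have "0 < r * (C - c)"
    using assms by simp
  then show ?thesis
    using assms by (simp add: F_def min_less_iff_disj)
qed

lemma less_F_A: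
  assumes "0 < r" and "A < c" and "c < C"
  shows "c < F A"
proof -
  have "0 < r * (c - A)"
    using assms by simp
  then show ?thesis
    using assms unfolding F_def by (simp add: right_diff_distrib less_max_iff_disj)
qed

end

section \<open>The Poincare map as a clamped reflection\<close>

theorem theorem4p6:
  fixes C0 C1 C2 C3 \<beta> \<xi> :: real
  assumes "C0 > 0" and "C1 > 0" and "C2 > 0" and "C3 > 0"
    and "C3 < min C0 (C1 + C2)"
    and "\<beta> \<in> {0..1}" and "\<xi> \<in> {0..1}"
    and "1 - C2 / C3 < \<xi>" and "\<xi> < C1 / C3" and "\<beta> < \<xi>"
  shows
    "let A1 = dm_A1 C0 C2 C3 \<beta> \<xi>;
         P = periodical_points {0..C1} (poincare_map C0 C1 C2 C3 \<beta> \<xi>);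
         v\<^sub>0 = \<xi> * C3
     in P 1 = {v\<^sub>0}
      \<and> (\<xi> < 1 / 2 \<longrightarrow>
           (let v\<^sub>m = max A1 (C3 - (1 - \<xi>) / \<xi> * C1);
                v\<^sub>p = min C1 (C3 - (1 - \<xi>) / \<xi> * A1)
            in v\<^sub>m < v\<^sub>0 \<and> v\<^sub>0 < v\<^sub>p \<and> P 2 = {v\<^sub>m, v\<^sub>p}))
      \<and> (\<xi> = 1 / 2 \<longrightarrow>
           (let v\<^sub>m = max A1 (C3 - C1);
                v\<^sub>p = min C1 (C3 - A1)
            in infinite (P 2) \<and> P 2 = {v\<^sub>m..v\<^sub>p} - {v\<^sub>0}))
      \<and> (\<xi> > 1 / 2 \<longrightarrow> P 2 = {})
      \<and> (\<forall>n \<ge> 3. P n = {})"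
proof -
  define A where "A = dm_A1 C0 C2 C3 \<beta> \<xi>"
  define c where "c = \<xi> * C3"
  define r where "r = (1 - \<xi>) / \<xi>"
  have \<xi>: "0 < \<xi>" "\<xi> \<le> 1" and "0 \<le> \<beta>"
    using assms by auto
  \<comment> \<open>This turns \<open>C3 - r * v\<close> into the reflection
    \<open>c - r * (v - c)\<close>.\<close>
  have r_c: "r * c = C3 - c"
    using \<xi> by (simp add: r_def c_def field_simps)
  have "c < C1"
    using assms by (simp add: c_def field_simps)
  have "\<beta> * C3 < c"
    using assms by (simp add: c_def)
  moreover have "C3 - C2 < c"
    using assms by (simp add: c_def field_simps)
  moreover have "(1 - \<xi>) * C3 \<le> (1 - \<xi>) * C0"
    using assms by (intro mult_left_mono) auto
  then have "C3 - (1 - \<xi>) * C0 \<le> c"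
    by (simp add: c_def algebra_simps)
  ultimately have "A \<le> c"
    by (simp add: A_def dm_A1_def)
  \<comment> \<open>At \<xi> = 1 the bound that involves \<open>C0\<close> is \<open>C3\<close>,
    which then equals \<open>c\<close>, so strictness fails.\<close>
  have "A < c" if "\<xi> < 1"
  proof -
    have "(1 - \<xi>) * C3 < (1 - \<xi>) * C0"
      using assms that by (intro mult_strict_left_mono) auto
    then have "C3 - (1 - \<xi>) * C0 < c"
      by (simp add: c_def algebra_simps)
    then show ?thesis
      using \<open>\<beta> * C3 < c\<close> \<open>C3 - C2 < c\<close> by (simp add: A_def dm_A1_def)
  qed
  have "0 \<le> \<beta> * C3"
    using \<open>0 \<le> \<beta>\<close> \<open>C3 > 0\<close> by simp
  then have "0 \<le> A"
    by (auto simp: A_def dm_A1_def)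
  interpret clamped_reflection A C1 c r
    using \<open>A \<le> c\<close> \<open>c < C1\<close> \<xi> by unfold_locales (auto simp: r_def)
  have F_alt: "F v = min C1 (max A (C3 - r * v))" for v
    using r_c by (simp add: F_def algebra_simps)
  have F_eq: "poincare_map C0 C1 C2 C3 \<beta> \<xi> = F"
    unfolding poincare_map_def F_alt A_def[symmetric] r_def[symmetric] by (rule ext) simp
  define P where "P = periodical_points {0..C1} F"
  \<comment> \<open>Fixed points of the square are values of \<open>F\<close>, so restricting to the
    domain loses none of them.\<close>
  have "v \<in> {0..C1}" if "F (F v) = v" for v
    using F_in[of "F v"] that \<open>0 \<le> A\<close> by auto
  then have P2: "P 2 = {v. F (F v) = v} - {c}"
    by (auto simp: P_def periodical_points_2 F_fixpoint_iff simp del: atLeastAtMost_iff)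
  have "P 1 = {c}"
    using \<open>0 \<le> A\<close> \<open>A \<le> c\<close> \<open>c < C1\<close> F_fixpoint_iff
    unfolding P_def periodical_points_1 by auto
  moreover have "P n = {}" if "3 \<le> n" for n
    unfolding P_def using antimono_F that by (rule antimono_periodical_points_empty)
  moreover have "P 2 = {}" if "\<xi> > 1 / 2"
  proof -
    have "r < 1"
      using that by (simp add: r_def field_simps)
    then show ?thesis
      using F_F_eq_contracting P2 by auto
  qed
  moreover have "infinite (P 2) \<and> P 2 = {max A (C3 - C1)..min C1 (C3 - A)} - {c}"
    if "\<xi> = 1 / 2"
  proof -
    have "r = 1" and C3: "C3 = 2 * c"
      using that by (simp_all add: r_def c_def)
    have P2': "P 2 = {max A (C3 - C1)..min C1 (C3 - A)} - {c}"
      unfolding P2 F_F_eq_isometric[OF \<open>r = 1\<close>] C3 Collect_mem_eq ..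
    have "max A (C3 - C1) < min C1 (C3 - A)"
      using \<open>\<xi> < 1 \<Longrightarrow> A < c\<close> \<open>c < C1\<close> C3 that by simp
    then show ?thesis
      using P2' by (simp add: infinite_Icc del: max_less_iff_conj min_less_iff_conj)
  qed
  moreover have "max A (C3 - r * C1) < c \<and> c < min C1 (C3 - r * A) \<and>
      P 2 = {max A (C3 - r * C1), min C1 (C3 - r * A)}" if "\<xi> < 1 / 2"
  proof -
    have "1 < r"
      using that \<xi> by (simp add: r_def field_simps)
    have "A < c"
      using \<open>\<xi> < 1 \<Longrightarrow> A < c\<close> that by simp
    have less: "F C1 < c" "c < F A"
      using F_C_less less_F_A \<open>1 < r\<close> \<open>A < c\<close> \<open>c < C1\<close> by simp_all
    \<comment> \<open>Below \<open>c\<close> the upper clamp is inactive, and above \<open>c\<close>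
      the lower one, which leaves the stated closed forms.\<close>
    moreover have "F C1 = max A (C3 - r * C1)" "F A = min C1 (C3 - r * A)"
      using less \<open>A < c\<close> \<open>c < C1\<close> F_alt[of C1] F_alt[of A] by linarith+
    moreover have "P 2 = {F C1, F A}"
      using less unfolding P2 F_F_eq_expanding[OF \<open>1 < r\<close>] by auto
    ultimately show ?thesis
      by simp
  qed
  ultimately show ?thesis
    unfolding Let_def F_eq
    unfolding A_def[symmetric] c_def[symmetric] r_def[symmetric] P_def[symmetric]
    by blast
qed

end
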